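(* Let $f:\mathbb{R}^d\to\mathbb{R}\cup\{+\infty\}$ be proper, closed, convex and $L$-Lipschitz smooth ($L>0$), with nonempty solution set; let $f_*=\min f$ and let $\mathbf{x}_*$ be any minimizer. Let $K\ge 1$ and let $\mathbf{x}_0,\dots,\mathbf{x}_K$ be generated by iGOGM (see context) with inexact gradients $\tilde\nabla f(\mathbf{x}_k)=\nabla f(\mathbf{x}_k)+\mathbf{e}_k$ satisfying $\|\mathbf{e}_k\|^2\le b_k^2$, where $b_k\ge 0$, $k=0,\dots,K-1$. Assume $\alpha_k^2<A_k$ for $k=1,\dots,K$. Then $$f(\mathbf{x}_K)-f_*-\frac{1}{2L}\|\nabla f(\mathbf{x}_K)\|^2\le \frac{L\|\mathbf{x}_0-\mathbf{x}_*\|^2}{4A_K}+\sum_{k=0}^{K-1}\hat u_k b_k^2,$$ where $\hat u_k=(\mathbf{H}\mathbf{b})_k/b_k$ with $\mathbf{b}=(b_0,\dots,b_{K-1})^\top$ and $\mathbf{H}$ given in the context (the product $\hat u_kb_k^2$ being read as $b_k(\mathbf{H}\mathbf{b})_k$), and $$\sum_{k=0}^{K-1}\hat u_kb_k^2=\sum_{j=1}^{K}\frac{\left[A_{j-1}b_{j-1}+2\alpha_j\sum_{i=0}^{j-1}\alpha_ib_i\right]^2}{4LA_K(A_j-\alpha_j^2)}.$$ In particular, when $b_i\equiv b>0$, for $k=0,\dots,K-1$, $$\hat u_k=\frac{A_k(1+2\alpha_{k+1})(A_k+2\alpha_k\alpha_{k+1})}{4LA_K(A_{k+1}-\alpha_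{k+1}^2)}+\sum_{i=k+1}^{K-1}\frac{A_i(1+2\alpha_{i+1})\alpha_k\alpha_{i+1}}{2LA_K(A_{i+1}-\alpha_{i+1}^2)}.$$
   Context: iGOGM (Inexact Generalized Optimized Gradient Method): $\mathbf{z}_0=\mathbf{x}_0\in\mathbb{R}^d$, $A_0=\alpha_0=1$, parameters $\lambda_1,\dots,\lambda_K\in[0,1]$. For $k=0,\dots,K-1$: $$\mathbf{y}_{k+1}=\mathbf{x}_k-\tfrac1L\tilde\nabla f(\mathbf{x}_k),\qquad \mathbf{z}_{k+1}=\mathbf{z}_k-\tfrac{2}{L}\alpha_k\tilde\nabla f(\mathbf{x}_k),$$ $$\alpha_{k+1}=\frac{\lambda_{k+1}+\sqrt{4\lambda_{k+1}A_k+\lambda_{k+1}^2}}{2},\qquad A_{k+1}=A_k+\alpha_{k+1},$$ $$\mathbf{x}_{k+1}=\Big(1-\frac{\alpha_{k+1}}{A_{k+1}}\Big)\mathbf{y}_{k+1}+\frac{\alpha_{k+1}}{A_{k+1}}\mathbf{z}_{k+1}.$$ (Thus $\alpha_k^2=\lambda_kA_k$ for $k\ge1$.) The symmetric matrix $\mathbf{H}\in\mathbb{R}^{K\times K}$, with rows and columns indexed by $0,\dots,K-1$, is $$H_{il}=\sum_{j=\max\{i,l\}+1}^{K}\frac{c_{i,j}\,c_{l,j}}{4LA_K(A_j-\alpha_j^2)},\qquad c_{j-1,j}=A_{j-1}+2\alpha_{j-1}\alpha_j,\quad c_{i,j}=2\alpha_i\alpha_j\ \ (i\le j-2).$$ "$L$-Lipschitz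 smooth" means differentiable with $L$-Lipschitz gradient; $\|\cdot\|$ is the Euclidean norm. *)

theory Defs
  imports "HOL-Analysis.Analysis"
begin

definition ereal_epigraph :: "('a \<Rightarrow> ereal) \<Rightarrow> ('a \<times> real) set" where
  "ereal_epigraph f = {(x, r). f x \<le> ereal r}"

definition proper_fun :: "('a \<Rightarrow> ereal) \<Rightarrow> bool" where
  "proper_fun f \<longleftrightarrow> (\<forall>x. f x \<noteq> -\<infinity>) \<and> (\<exists>x. f x \<noteq> \<infinity>)"

definition closed_fun :: "('a::topological_space \<Rightarrow> ereal) \<Rightarrow> bool" where
  "closed_fun f \<longleftrightarrow> closed (ereal_epigraph f)"

definition convex_fun :: "('a::real_vector \<Rightarrow> ereal) \<Rightarrow> bool" where
  "convex_fun f \<longleftrightarrow> convex (ereal_epigraph f)"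

definition solution_set :: "('a \<Rightarrow> ereal) \<Rightarrow> 'a set" where
  "solution_set f = {x. \<forall>y. f x \<le> f y}"

(* Only used for functions that are finite and differentiable everywhere, where the
   description determines the gradient uniquely. *)
definition grad :: "('a::real_inner \<Rightarrow> ereal) \<Rightarrow> 'a \<Rightarrow> 'a" where
  "grad f x = (THE g. GDERIV (\<lambda>y. real_of_ereal (f y)) x :> g)"

(* Differentiability on the whole space presupposes finite values. *)
definition lipschitz_smooth :: "real \<Rightarrow> ('a::real_inner \<Rightarrow> ereal) \<Rightarrow> bool" where
  "lipschitz_smooth L f \<longleftrightarrow>
     (\<forall>x. \<bar>f x\<bar> \<noteq> \<infinity>) \<and>
     (\<forall>x. (\<lambda>y. real_of_ereal (f y)) differentiable (at x)) \<and>
     L-lipschitz_on UNIV (grad f)"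

(* The parameters are lam 1, lam 2, ...; the value lam 0 is unused. *)
fun igogm_\<alpha> :: "(nat \<Rightarrow> real) \<Rightarrow> nat \<Rightarrow> real"
  and igogm_A :: "(nat \<Rightarrow> real) \<Rightarrow> nat \<Rightarrow> real" where
  "igogm_\<alpha> lam 0 = 1"
| "igogm_\<alpha> lam (Suc k) =
     (lam (Suc k) + sqrt (4 * lam (Suc k) * igogm_A lam k + (lam (Suc k))\<^sup>2)) / 2"
| "igogm_A lam 0 = 1"
| "igogm_A lam (Suc k) = igogm_A lam k + igogm_\<alpha> lam (Suc k)"

(* x, y, z are the first K steps of the method, where gt k is the inexact gradient
   supplied at x k.  There is no y 0 in the method, so y 0 is unconstrained. *)
definition igogm ::
  "real \<Rightarrow> (nat \<Rightarrow> real) \<Rightarrow> nat \<Rightarrow> (nat \<Rightarrow> 'a::real_vector) \<Rightarrow>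
   (nat \<Rightarrow> 'a) \<Rightarrow> (nat \<Rightarrow> 'a) \<Rightarrow> (nat \<Rightarrow> 'a) \<Rightarrow> bool" where
  "igogm L lam K gt x y z \<longleftrightarrow>
     z 0 = x 0 \<and>
     (\<forall>k<K.
        y (Suc k) = x k - (1 / L) *\<^sub>R gt k \<and>
        z (Suc k) = z k - (2 / L * igogm_\<alpha> lam k) *\<^sub>R gt k \<and>
        x (Suc k) =
          (1 - igogm_\<alpha> lam (Suc k) / igogm_A lam (Suc k)) *\<^sub>R y (Suc k) +
          (igogm_\<alpha> lam (Suc k) / igogm_A lam (Suc k)) *\<^sub>R z (Suc k))"

(* Only meaningful, and only used, for i < j. *)
definition igogm_c :: "(nat \<Rightarrow> real) \<Rightarrow> nat \<Rightarrow> nat \<Rightarrow> real" where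
  "igogm_c lam i j =
     (if Suc i = j then igogm_A lam i + 2 * igogm_\<alpha> lam i * igogm_\<alpha> lam j
      else 2 * igogm_\<alpha> lam i * igogm_\<alpha> lam j)"

(* Entries of the K x K matrix H, rows and columns indexed by 0, ..., K-1. *)
definition igogm_H :: "real \<Rightarrow> (nat \<Rightarrow> real) \<Rightarrow> nat \<Rightarrow> nat \<Rightarrow> nat \<Rightarrow> real" where
  "igogm_H L lam K i l =
     (\<Sum>j = max i l + 1..K.
        igogm_c lam i j * igogm_c lam l j /
        (4 * L * igogm_A lam K * (igogm_A lam j - (igogm_\<alpha> lam j)\<^sup>2)))"

(* (H b)_k / b_k.  For b k = 0 the quotient is 0, so in all cases
   igogm_u L lam K b k * (b k)^2 = b k * (H b)_k, as intended. *)
definition igogm_u :: "real \<Rightarrow> (nat \<Rightarrow> real) \<Rightarrow> nat \<Rightarrow> (nat \<Rightarrow> real) \<Rightarrow> nat \<Rightarrow> real" where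
  "igogm_u L lam K b k = (\<Sum>l<K. igogm_H L lam K k l * b l) / b k"

end

theory Submission imports Defs begin

text \<open>Put \<open>h k = f (x k) - min f - (norm (grad f (x k)))\<^sup>2 / (2 * L)\<close> and let \<open>w k\<close> be \<open>z k\<close> with
  the errors \<open>e i\<close> removed from its recursion. The quantity
  \<open>A k * h k + L / 4 * (norm (w (k + 1) - xstar))\<^sup>2\<close> is a potential: adding \<open>A (k - 1)\<close> times the
  interpolation inequality between \<open>x (k - 1)\<close> and \<open>x k\<close> to \<open>\<alpha> k\<close> times the one between \<open>xstar\<close>
  and \<open>x k\<close>, its increase in one step is at most
  \<open>- (A k - (\<alpha> k)\<^sup>2) * (norm g)\<^sup>2 / L - (g \<bullet> v) / L\<close> with \<open>g = grad f (x k)\<close> and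
  \<open>v = A (k - 1) * e (k - 1) + 2 * \<alpha> k * (\<Sum>i<k. \<alpha> i * e i)\<close>. As the errors enter only through \<open>v\<close>,
  Young's inequality bounds this by \<open>(norm v)\<^sup>2 / (4 * L * (A k - (\<alpha> k)\<^sup>2))\<close>, independently of
  \<open>xstar\<close>; summing over \<open>k\<close> gives the quadratic form of \<open>H\<close>.\<close>

section \<open>Smooth convex functions\<close>

lemma GDERIV_along_line:
  fixes F :: "'a::real_inner \<Rightarrow> real"
  assumes "\<And>x. GDERIV F x :> G x"
  shows "((\<lambda>t. F (u + t *\<^sub>R d)) has_real_derivative G (u + t *\<^sub>R d) \<bullet> d) (at t)"
proof -
  have line: "((\<lambda>t. u + t *\<^sub>R d) has_derivative (\<lambda>h. h *\<^sub>R d)) (at t)"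
    by (auto intro!: derivative_eq_intros)
  have "(F has_derivative (\<lambda>h. h \<bullet> G (u + t *\<^sub>R d))) (at (u + t *\<^sub>R d))"
    using assms by (simp add: gderiv_def)
  from has_derivative_compose[OF line this] show ?thesis
    by (simp add: has_field_derivative_def inner_commute mult.commute[of _ "G _ \<bullet> d"]
        mult_commute_abs)
qed

text \<open>Restriction to the line through \<open>u\<close> and \<open>v\<close> reduces this to
  the tangent inequality in one real variable, taken at parameter 0 and evaluated at 1.\<close>

lemma convex_GDERIV_above_tangent:
  fixes F :: "'a::real_inner \<Rightarrow> real"
  assumes G: "\<And>x. GDERIV F x :> G x" and convex: "convex_on UNIV F"
  shows "F u + G u \<bullet> (v - u) \<le> F v"
proof -
  let ?q = "\<lambda>t. F (u + t *\<^sub>R (v - u))"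
  have "convex_on UNIV ?q"
  proof (rule convex_onI)
    fix t r s :: real
    assume t: "0 < t" "t < 1"
    have "u + ((1 - t) *\<^sub>R r + t *\<^sub>R s) *\<^sub>R (v - u)
        = (1 - t) *\<^sub>R (u + r *\<^sub>R (v - u)) + t *\<^sub>R (u + s *\<^sub>R (v - u))"
      by (simp add: algebra_simps)
    then show "?q ((1 - t) *\<^sub>R r + t *\<^sub>R s) \<le> (1 - t) * ?q r + t * ?q s"
      using convex_onD[OF convex, of t] t by simp
  qed auto
  then have "G (u + 0 *\<^sub>R (v - u)) \<bullet> (v - u) * (1 - 0) \<le> ?q 1 - ?q 0"
    by (rule convex_on_imp_above_tangent) (use GDERIV_along_line[OF G, of u "v - u" 0] in auto)
  then show ?thesis by simp
qed

text \<open>Monotonicity replaces integration: on the segment, \<open>F\<close> minus its linear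
  part and the quadratic bound has nonpositive derivative, by Cauchy-Schwarz and the Lipschitz
  condition.\<close>

lemma lipschitz_GDERIV_descent:
  fixes F :: "'a::real_inner \<Rightarrow> real"
  assumes G: "\<And>x. GDERIV F x :> G x" and lip: "L-lipschitz_on UNIV G"
  shows "F v \<le> F u + G u \<bullet> (v - u) + L / 2 * (norm (v - u))\<^sup>2"
proof -
  define d where "d = v - u"
  let ?q = "\<lambda>t. F (u + t *\<^sub>R d) - t * (G u \<bullet> d) - L / 2 * t\<^sup>2 * (norm d)\<^sup>2"
  have "?q 1 \<le> ?q 0"
  proof (rule DERIV_nonpos_imp_nonincreasing[of 0 1 ?q])
    fix t :: real
    assume t: "0 \<le> t" "t \<le> 1"
    have "(?q has_real_derivative
        (G (u + t *\<^sub>R d) \<bullet> d - G u \<bullet> d - L * t * (norm d)\<^sup>2)) (at t)"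
      by (rule derivative_eq_intros GDERIV_along_line[OF G] refl | simp)+
    moreover have "(G (u + t *\<^sub>R d) - G u) \<bullet> d \<le> L * t * (norm d)\<^sup>2"
    proof -
      have "norm (G (u + t *\<^sub>R d) - G u) \<le> L * (t * norm d)"
        using lipschitz_onD[OF lip, of "u + t *\<^sub>R d" u] t by (simp add: dist_norm)
      then have "norm (G (u + t *\<^sub>R d) - G u) * norm d \<le> L * (t * norm d) * norm d"
        by (rule mult_right_mono) simp
      with norm_cauchy_schwarz[of "G (u + t *\<^sub>R d) - G u" d] show ?thesis
        by (simp add: power2_eq_square mult.assoc)
    qed
    ultimately show "\<exists>D. DERIV ?q t :> D \<and> D \<le> 0"
      by (auto simp: inner_diff_left)
  qed simp
  then show ?thesis by (simp add: d_def)
qed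

text \<open>The tangent inequality at \<open>v\<close> and the descent inequality at \<open>u\<close> are compared at the
  point reached from \<open>u\<close> by a gradient step of length \<open>1 / L\<close> on \<open>F - G v \<bullet> _\<close>.\<close>

lemma smooth_convex_interpolation:
  fixes F :: "'a::real_inner \<Rightarrow> real"
  assumes G: "\<And>x. GDERIV F x :> G x" and convex: "convex_on UNIV F"
    and lip: "L-lipschitz_on UNIV G" and "L > 0"
  shows "F v + G v \<bullet> (u - v) + 1 / (2 * L) * (norm (G u - G v))\<^sup>2 \<le> F u"
proof -
  define D where "D = G u - G v"
  define w where "w = u - (1 / L) *\<^sub>R D"
  have "F v + G v \<bullet> (w - v) \<le> F w"
    by (rule convex_GDERIV_above_tangent[OF G convex])
  moreover have "F w \<le> F u + G u \<bullet> (w - u) + L / 2 * (norm (w - u))\<^sup>2"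
    by (rule lipschitz_GDERIV_descent[OF G lip])
  moreover have "L / 2 * (norm (w - u))\<^sup>2 = 1 / (2 * L) * (D \<bullet> D)"
    using \<open>L > 0\<close> by (simp add: w_def dot_square_norm power2_eq_square field_simps)
  \<comment> \<open>The step gains \<open>1 / L * (D \<bullet> D)\<close>; the quadratic term of the
    descent inequality costs half of it, and the other half is the squared norm in the
    claim.\<close>
  moreover have "G v \<bullet> (w - v) - G u \<bullet> (w - u) = G v \<bullet> (u - v) + 1 / L * (D \<bullet> D)"
    using \<open>L > 0\<close> by (simp add: w_def D_def inner_simps inner_commute field_simps)
  moreover have "1 / L * (D \<bullet> D) = 2 * (1 / (2 * L) * (D \<bullet> D))"
    by simp
  ultimately show ?thesis
    unfolding D_def[symmetric] power2_norm_eq_inner by linarith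
qed

lemma convex_fun_imp_convex_on:
  assumes "convex_fun f" and finite: "\<And>x. \<bar>f x\<bar> \<noteq> \<infinity>"
  shows "convex_on UNIV (\<lambda>x. real_of_ereal (f x))"
proof (rule convex_onI)
  fix t :: real and u v :: 'a
  let ?F = "\<lambda>x. real_of_ereal (f x)"
  assume t: "0 < t" "t < 1"
  have fF: "f x = ereal (?F x)" for x
    using finite by (simp add: ereal_real)
  \<comment> \<open>Finiteness puts the whole graph into the epigraph, so a convex combination of
    two graph points yields Jensen's inequality.\<close>
  have "(w, ?F w) \<in> ereal_epigraph f" for w
    using fF[of w] by (simp add: ereal_epigraph_def)
  with assms(1) t
  have "(1 - t) *\<^sub>R (u, ?F u) + t *\<^sub>R (v, ?F v) \<in> ereal_epigraph f"
    unfolding convex_fun_def by (intro convexD) auto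
  then have "f ((1 - t) *\<^sub>R u + t *\<^sub>R v) \<le> ereal ((1 - t) * ?F u + t * ?F v)"
    by (simp add: ereal_epigraph_def)
  then show "?F ((1 - t) *\<^sub>R u + t *\<^sub>R v) \<le> (1 - t) * ?F u + t * ?F v"
    using fF[of "(1 - t) *\<^sub>R u + t *\<^sub>R v"] by (metis ereal_less_eq(3))
qed simp

text \<open>As \<open>grad\<close> is a definite description, existence and uniqueness are both
  required. Existence is Riesz representation: the gradient is the adjoint of the derivative at
  1.\<close>

lemma GDERIV_grad:
  fixes f :: "'a::euclidean_space \<Rightarrow> ereal"
  assumes "(\<lambda>y. real_of_ereal (f y)) differentiable (at x)"
  shows "GDERIV (\<lambda>y. real_of_ereal (f y)) x :> grad f x"
proof -
  let ?F = "\<lambda>y. real_of_ereal (f y)"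
  obtain f' where f': "(?F has_derivative f') (at x)"
    using assms by (auto simp: differentiable_def)
  then have "h \<bullet> adjoint f' 1 = f' h" for h
    using adjoint_works[of f' h 1] by (simp add: has_derivative_linear)
  with f' have "GDERIV ?F x :> adjoint f' 1"
    by (simp add: gderiv_def)
  moreover have "g = g'" if "GDERIV ?F x :> g" "GDERIV ?F x :> g'" for g g'
  proof -
    have "(\<lambda>h. h \<bullet> g) = (\<lambda>h. h \<bullet> g')"
      using that has_derivative_unique unfolding gderiv_def by blast
    then show ?thesis by (metis vector_eq_ldot)
  qed
  ultimately show ?thesis
    unfolding grad_def by (metis (mono_tags, lifting) theI)
qed

lemma GDERIV_minimum_eq_0:
  assumes G: "\<And>x. GDERIV F x :> G x" and min: "\<And>x. F u \<le> F x"
  shows "G u = 0"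
proof -
  have "(F has_derivative (\<lambda>h. h \<bullet> G u)) (at u)"
    using G by (simp add: gderiv_def)
  then have "(\<lambda>h. h \<bullet> G u) = (\<lambda>h. 0)"
    using min by (intro differential_zero_maxmin[of u UNIV F]) auto
  then show ?thesis by (metis inner_eq_zero_iff)
qed

section \<open>The step sizes and the matrix \<open>H\<close>\<close>

lemma igogm_nonneg:
  assumes "\<forall>k\<in>{1..K}. 0 \<le> lam k" "k \<le> K"
  shows "0 \<le> igogm_\<alpha> lam k \<and> 1 \<le> igogm_A lam k"
  using assms(2)
proof (induction k)
  case (Suc k)
  then have "0 \<le> lam (Suc k)" "1 \<le> igogm_A lam k"
    using assms(1) by auto
  then show ?case by (simp add: add_increasing2)
qed simp

lemma igogm_A_eq_sum: "igogm_A lam k = (\<Sum>i\<le>k. igogm_\<alpha> lam i)"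
  by (induction k) auto

text \<open>From here on the step sizes stay symbolic, so that simplification does not expand the
  square roots.\<close>

declare igogm_\<alpha>.simps(2) [simp del] igogm_A.simps(2) [simp del]

text \<open>This explains the coefficients: \<open>igogm_c lam i j\<close> is the weight of the
  error \<open>e i\<close> in the vector \<open>v\<close> of step \<open>j\<close>, and only
  \<open>i = j - 1\<close> receives the extra summand \<open>A (j - 1)\<close>.\<close>

lemma sum_igogm_c:
  assumes "1 \<le> j"
  shows "(\<Sum>i<j. igogm_c lam i j * b i)
    = igogm_A lam (j - 1) * b (j - 1) + 2 * igogm_\<alpha> lam j * (\<Sum>i<j. igogm_\<alpha> lam i * b i)"
proof -
  obtain m where j: "j = Suc m"
    using assms by (cases j) auto
  have "igogm_c lam i j * b i
      = (if i = m then igogm_A lam i * b i else 0) + 2 * igogm_\<alpha> lam j * (igogm_\<alpha> lam i * b i)" for i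
    by (simp add: igogm_c_def j algebra_simps)
  then show ?thesis
    by (simp only: sum.distrib sum_distrib_left[symmetric]) (simp add: j)
qed

text \<open>\<open>H\<close> is a sum over \<open>j\<close> of scaled rank-one matrices, each built
  from the vector of the \<open>igogm_c lam i j\<close> with \<open>i < j\<close>. The lower limit
  \<open>max k l + 1\<close> says that \<open>j\<close> exceeds both indices, so the sums can be
  swapped.\<close>

lemma sum_igogm_H:
  assumes "k < K"
  shows "(\<Sum>l<K. igogm_H L lam K k l * b l)
    = (\<Sum>j = k + 1..K. igogm_c lam k j * (\<Sum>l<j. igogm_c lam l j * b l)
        / (4 * L * igogm_A lam K * (igogm_A lam j - (igogm_\<alpha> lam j)\<^sup>2)))"
proof -
  let ?t = "\<lambda>l j. igogm_c lam k j * (igogm_c lam l j * b l)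
        / (4 * L * igogm_A lam K * (igogm_A lam j - (igogm_\<alpha> lam j)\<^sup>2))"
  have "(\<Sum>l<K. igogm_H L lam K k l * b l) = (\<Sum>l<K. \<Sum>j | j \<in> {k + 1..K} \<and> l < j. ?t l j)"
  proof (rule sum.cong[OF refl])
    fix l
    have "{max k l + 1..K} = {j. j \<in> {k + 1..K} \<and> l < j}" by auto
    then show "igogm_H L lam K k l * b l = (\<Sum>j | j \<in> {k + 1..K} \<and> l < j. ?t l j)"
      by (simp add: igogm_H_def sum_distrib_right mult.assoc)
  qed
  also have "\<dots> = (\<Sum>j = k + 1..K. \<Sum>l | l \<in> {..<K} \<and> l < j. ?t l j)"
    by (rule sum.swap_restrict) auto
  also have "\<dots> = (\<Sum>j = k + 1..K. \<Sum>l<j. ?t l j)"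
  proof (rule sum.cong[OF refl])
    fix j assume "j \<in> {k + 1..K}"
    then have "{l. l \<in> {..<K} \<and> l < j} = {..<j}" by auto
    then show "(\<Sum>l | l \<in> {..<K} \<and> l < j. ?t l j) = (\<Sum>l<j. ?t l j)" by simp
  qed
  finally show ?thesis
    by (simp add: sum_distrib_left sum_divide_distrib)
qed

text \<open>The left side is the quadratic form of \<open>H\<close> at \<open>b\<close>, so each
  rank-one summand contributes a square.\<close>

lemma sum_igogm_u:
  "(\<Sum>k<K. igogm_u L lam K b k * (b k)\<^sup>2)
    = (\<Sum>j = 1..K.
        (igogm_A lam (j - 1) * b (j - 1) + 2 * igogm_\<alpha> lam j * (\<Sum>i<j. igogm_\<alpha> lam i * b i))\<^sup>2
        / (4 * L * igogm_A lam K * (igogm_A lam j - (igogm_\<alpha> lam j)\<^sup>2)))"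
proof -
  let ?D = "\<lambda>j. 4 * L * igogm_A lam K * (igogm_A lam j - (igogm_\<alpha> lam j)\<^sup>2)"
  let ?S = "\<lambda>j. \<Sum>l<j. igogm_c lam l j * b l"
  let ?t = "\<lambda>k j. igogm_c lam k j * b k * ?S j / ?D j"
  have "(\<Sum>k<K. igogm_u L lam K b k * (b k)\<^sup>2) = (\<Sum>k<K. \<Sum>j | j \<in> {1..K} \<and> k < j. ?t k j)"
  proof (rule sum.cong[OF refl])
    fix k assume "k \<in> {..<K}"
    \<comment> \<open>For \<open>b k = 0\<close> both sides vanish, so no positivity is
      required.\<close>
    then have "igogm_u L lam K b k * (b k)\<^sup>2
        = b k * (\<Sum>j = k + 1..K. igogm_c lam k j * ?S j / ?D j)"
      using sum_igogm_H[of k K L lam b] by (simp add: igogm_u_def power2_eq_square)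
    also have "\<dots> = (\<Sum>j = k + 1..K. ?t k j)"
      by (simp add: sum_distrib_left mult_ac)
    also have "{k + 1..K} = {j. j \<in> {1..K} \<and> k < j}" by auto
    finally show "igogm_u L lam K b k * (b k)\<^sup>2 = (\<Sum>j | j \<in> {1..K} \<and> k < j. ?t k j)" .
  qed
  also have "\<dots> = (\<Sum>j = 1..K. \<Sum>k | k \<in> {..<K} \<and> k < j. ?t k j)"
    by (rule sum.swap_restrict) auto
  also have "\<dots> = (\<Sum>j = 1..K. (?S j)\<^sup>2 / ?D j)"
  proof (rule sum.cong[OF refl])
    fix j assume "j \<in> {1..K}"
    then have "{k. k \<in> {..<K} \<and> k < j} = {..<j}" by auto
    then show "(\<Sum>k | k \<in> {..<K} \<and> k < j. ?t k j) = (?S j)\<^sup>2 / ?D j"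
      by (simp add: power2_eq_square sum_distrib_right sum_divide_distrib)
  qed
  finally show ?thesis
    using sum_igogm_c[of _ lam b] by (metis (no_types, lifting) atLeastAtMost_iff sum.cong)
qed

text \<open>For constant \<open>b\<close> the inner sums collapse, because the \<alpha>'s add up to
  \<open>A\<close>. The term \<open>j = k + 1\<close> stands apart because its coefficient is the
  exceptional one.\<close>

lemma igogm_u_const:
  assumes "\<beta> > 0" "\<forall>i<K. b i = \<beta>" "k < K"
  shows "igogm_u L lam K b k =
       igogm_A lam k * (1 + 2 * igogm_\<alpha> lam (k + 1))
         * (igogm_A lam k + 2 * igogm_\<alpha> lam k * igogm_\<alpha> lam (k + 1))
         / (4 * L * igogm_A lam K * (igogm_A lam (k + 1) - (igogm_\<alpha> lam (k + 1))\<^sup>2))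
       + (\<Sum>i = k + 1..<K.
            igogm_A lam i * (1 + 2 * igogm_\<alpha> lam (i + 1)) * igogm_\<alpha> lam k * igogm_\<alpha> lam (i + 1)
            / (2 * L * igogm_A lam K * (igogm_A lam (i + 1) - (igogm_\<alpha> lam (i + 1))\<^sup>2)))"
proof -
  let ?D = "\<lambda>j. 4 * L * igogm_A lam K * (igogm_A lam j - (igogm_\<alpha> lam j)\<^sup>2)"
  let ?t = "\<lambda>j. igogm_c lam k j * (\<Sum>l<j. igogm_c lam l j * b l) / ?D j"
  have row: "(\<Sum>l<Suc i. igogm_c lam l (Suc i) * b l)
      = igogm_A lam i * (1 + 2 * igogm_\<alpha> lam (Suc i)) * \<beta>" if "i < K" for i
  proof -
    have "(\<Sum>l<Suc i. igogm_\<alpha> lam l * b l) = igogm_A lam i * \<beta>"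
      using that assms(2)
      by (simp add: igogm_A_eq_sum sum_distrib_right lessThan_Suc_atMost)
    then show ?thesis
      using that assms(2) sum_igogm_c[of "Suc i" lam b]
      by (simp add: distrib_left distrib_right mult_ac del: sum.lessThan_Suc)
  qed
  have "(\<Sum>j = k + 1..K. ?t j) = (\<Sum>i = k..<K. ?t (Suc i))"
    using sum.shift_bounds_Suc_ivl[of ?t k K] by (simp only: Suc_eq_plus1[symmetric] atLeastLessThanSuc_atLeastAtMost)
  then have "igogm_u L lam K b k = (\<Sum>i = k..<K. ?t (Suc i)) / \<beta>"
    using assms by (simp only: igogm_u_def sum_igogm_H)
  also have "\<dots> = ?t (Suc k) / \<beta> + (\<Sum>i = k + 1..<K. ?t (Suc i) / \<beta>)"
    using assms(3) by (simp add: sum.atLeast_Suc_lessThan add_divide_distrib sum_divide_distrib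
        del: sum.lessThan_Suc)
  also have "?t (Suc k) / \<beta> = igogm_A lam k * (1 + 2 * igogm_\<alpha> lam (k + 1))
         * (igogm_A lam k + 2 * igogm_\<alpha> lam k * igogm_\<alpha> lam (k + 1)) / ?D (k + 1)"
    using assms row[of k]
    by (simp add: igogm_c_def mult_ac del: sum.lessThan_Suc)
  also have "(\<Sum>i = k + 1..<K. ?t (Suc i) / \<beta>) = (\<Sum>i = k + 1..<K.
            igogm_A lam i * (1 + 2 * igogm_\<alpha> lam (i + 1)) * igogm_\<alpha> lam k * igogm_\<alpha> lam (i + 1)
            / (2 * L * igogm_A lam K * (igogm_A lam (i + 1) - (igogm_\<alpha> lam (i + 1))\<^sup>2)))"
  proof (rule sum.cong[OF refl])
    fix i assume i: "i \<in> {k + 1..<K}"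
    let ?N = "igogm_A lam i * (1 + 2 * igogm_\<alpha> lam (i + 1)) * igogm_\<alpha> lam k * igogm_\<alpha> lam (i + 1)"
    let ?E = "2 * L * igogm_A lam K * (igogm_A lam (i + 1) - (igogm_\<alpha> lam (i + 1))\<^sup>2)"
    \<comment> \<open>The factor 2 in the regular coefficients turns the constant 4 of the
      denominator into 2.\<close>
    have "?t (Suc i) / \<beta> = (2 * ?N) / (2 * ?E)"
      using i assms(1) row[of i]
      by (simp add: igogm_c_def mult_ac del: sum.lessThan_Suc mult_divide_mult_cancel_left_if)
    then show "?t (Suc i) / \<beta> = ?N / ?E" by (simp only: mult_divide_mult_cancel_left_if) simp
  qed
  finally show ?thesis .
qed

section \<open>The potential argument\<close>

text \<open>Complete the square: the vector \<open>2 * \<delta> * g + v\<close> has nonnegative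
  squared norm.\<close>

lemma inner_young_le:
  fixes g v :: "'a::real_inner"
  assumes "\<delta> > 0" "norm v \<le> B"
  shows "- (\<delta> * (g \<bullet> g)) - g \<bullet> v \<le> B\<^sup>2 / (4 * \<delta>)"
proof -
  have "0 \<le> ((2 * \<delta>) *\<^sub>R g + v) \<bullet> ((2 * \<delta>) *\<^sub>R g + v)" by simp
  also have "\<dots> = 4 * \<delta> * (\<delta> * (g \<bullet> g) + g \<bullet> v) + v \<bullet> v"
    by (simp add: inner_simps inner_commute algebra_simps)
  also have "v \<bullet> v \<le> B\<^sup>2"
    using assms(2) by (metis norm_ge_zero power2_norm_eq_inner power_mono)
  finally have "(- (\<delta> * (g \<bullet> g)) - g \<bullet> v) * (4 * \<delta>) \<le> B\<^sup>2"
    by (simp add: algebra_simps)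
  with assms(1) show ?thesis
    by (subst pos_le_divide_eq) auto
qed

text \<open>The weight \<open>L / 4\<close> is matched to the step length \<open>2 / L * a\<close>:
  the cross term gets coefficient exactly \<open>a\<close>, the weight of the inequality against the
  minimizer.\<close>

lemma gradient_step_dist:
  fixes g w u :: "'a::real_inner"
  assumes "L > 0"
  shows "L / 4 * (norm (w - (2 / L * a) *\<^sub>R g - u))\<^sup>2
      = L / 4 * (norm (w - u))\<^sup>2 - a * (g \<bullet> (w - u)) + a\<^sup>2 * (g \<bullet> g) / L"
proof -
  have eq: "w - c *\<^sub>R g - u = (w - u) - c *\<^sub>R g" for c
    by simp
  have "(norm (w - c *\<^sub>R g - u))\<^sup>2 = (norm (w - u))\<^sup>2 - 2 * c * (g \<bullet> (w - u)) + c\<^sup>2 * (g \<bullet> g)" for c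
    unfolding eq power2_norm_eq_inner
    by (simp only: inner_diff_left[of "w - u"] inner_diff_right[of _ "w - u"])
      (simp add: inner_commute[of g "w - u"] power2_eq_square)
  moreover have "L / 4 * (N - 2 * (2 / L * a) * P + (2 / L * a)\<^sup>2 * Q) = L / 4 * N - a * P + a\<^sup>2 * Q / L"
    for N P Q :: real
    using assms by (simp add: field_simps power2_eq_square)
  ultimately show ?thesis by (simp only:)
qed

text \<open>Here \<open>w\<close> is the point that \<open>z\<close> would be if the gradients were exact.\<close>

lemma igogm_potential_step:
  fixes g e x y z w s xs :: "'a::real_inner"
  assumes "L > 0" "A \<ge> 0" "a \<ge> 0" "a\<^sup>2 < A + a"
    and x: "(A + a) *\<^sub>R x = A *\<^sub>R y + a *\<^sub>R z"
    and z: "z = w - (2 / L) *\<^sub>R s"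
    and prev: "h + (g \<bullet> g) / L \<le> h' + g \<bullet> (x - y) - (g \<bullet> e) / L"
    and opt: "h + (g \<bullet> g) / L \<le> g \<bullet> (x - xs)"
    and B: "norm (A *\<^sub>R e + (2 * a) *\<^sub>R s) \<le> B"
  shows "(A + a) * h + L / 4 * (norm (w - (2 / L * a) *\<^sub>R g - xs))\<^sup>2
    \<le> A * h' + L / 4 * (norm (w - xs))\<^sup>2 + B\<^sup>2 / (4 * L * (A + a - a\<^sup>2))"
proof -
  define v where "v = A *\<^sub>R e + (2 * a) *\<^sub>R s"
  have "A * (h + (g \<bullet> g) / L) + a * (h + (g \<bullet> g) / L)
      \<le> A * (h' + g \<bullet> (x - y) - (g \<bullet> e) / L) + a * (g \<bullet> (x - xs))"
    by (intro add_mono mult_left_mono assms)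
  also have "\<dots> = A * h' + g \<bullet> ((A + a) *\<^sub>R x - A *\<^sub>R y - a *\<^sub>R xs) - A * (g \<bullet> e) / L"
    by (simp add: inner_simps algebra_simps)
  \<comment> \<open>The averaging rule for \<open>x\<close> eliminates \<open>y\<close>; writing
    \<open>z\<close> through \<open>w\<close> leaves only the accumulated errors \<open>s\<close>,
    which join \<open>e\<close> in \<open>v\<close>.\<close>
  also have "(A + a) *\<^sub>R x - A *\<^sub>R y - a *\<^sub>R xs = a *\<^sub>R (w - xs) - (2 / L * a) *\<^sub>R s"
    unfolding x z by (simp add: algebra_simps)
  also have "g \<bullet> \<dots> = a * (g \<bullet> (w - xs)) - 2 / L * a * (g \<bullet> s)"
    by (simp add: inner_simps)
  also have "A * h' + \<dots> - A * (g \<bullet> e) / L = A * h' + a * (g \<bullet> (w - xs)) - (g \<bullet> v) / L"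
    using \<open>L > 0\<close> by (simp add: v_def inner_simps field_simps)
  finally have 1: "(A + a) * h + (A + a) * (g \<bullet> g) / L
      \<le> A * h' + a * (g \<bullet> (w - xs)) - (g \<bullet> v) / L"
    by (simp add: algebra_simps add_divide_distrib)
  note 2 = gradient_step_dist[OF \<open>L > 0\<close>, of w a g xs]
  \<comment> \<open>Young's inequality with \<delta> equal to \<open>A + a - a\<^sup>2\<close>, the
    part of the squared gradient left after paying for the squared step of \<open>w\<close>.\<close>
  have "- ((A + a - a\<^sup>2) * (g \<bullet> g)) - g \<bullet> v \<le> B\<^sup>2 / (4 * (A + a - a\<^sup>2))"
    by (rule inner_young_le) (use assms in \<open>auto simp: v_def\<close>)
  then have "(- ((A + a - a\<^sup>2) * (g \<bullet> g)) - g \<bullet> v) / L \<le> B\<^sup>2 / (4 * (A + a - a\<^sup>2)) / L"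
    using \<open>L > 0\<close> by (intro divide_right_mono) auto
  also have "\<dots> = B\<^sup>2 / (4 * L * (A + a - a\<^sup>2))" by (simp add: mult_ac)
  finally have 3: "- ((A + a) * (g \<bullet> g) / L) + a\<^sup>2 * (g \<bullet> g) / L - (g \<bullet> v) / L
      \<le> B\<^sup>2 / (4 * L * (A + a - a\<^sup>2))"
    by (simp add: left_diff_distrib diff_divide_distrib)
  from 1 2 3 show ?thesis by linarith
qed

text \<open>Induction telescopes the one-step estimate. The index of \<open>w\<close> runs one
  ahead: \<open>w (Suc K)\<close> uses the exact gradient at \<open>x K\<close>, although the method
  stops at \<open>z K\<close>.\<close>

lemma igogm_potential_bound:
  fixes x y z e :: "nat \<Rightarrow> 'a::real_inner" and F :: "'a \<Rightarrow> real"
  assumes "L > 0"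
    and interp: "\<And>u v. F v + G v \<bullet> (u - v) + 1 / (2 * L) * (norm (G u - G v))\<^sup>2 \<le> F u"
    and "G xs = 0"
    and lam: "\<forall>k\<in>{1..K}. 0 \<le> lam k"
    and igogm: "igogm L lam K (\<lambda>k. G (x k) + e k) x y z"
    and e: "\<And>k. k < K \<Longrightarrow> norm (e k) \<le> b k"
    and \<alpha>: "\<forall>k\<in>{1..K}. (igogm_\<alpha> lam k)\<^sup>2 < igogm_A lam k"
    and "k \<le> K"
  defines "w \<equiv> \<lambda>k. x 0 - (2 / L) *\<^sub>R (\<Sum>i<k. igogm_\<alpha> lam i *\<^sub>R G (x i))"
  shows "igogm_A lam k * (F (x k) - F xs - 1 / (2 * L) * (norm (G (x k)))\<^sup>2)
        + L / 4 * (norm (w (Suc k) - xs))\<^sup>2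
      \<le> L / 4 * (norm (x 0 - xs))\<^sup>2
        + (\<Sum>j = 1..k.
            (igogm_A lam (j - 1) * b (j - 1) + 2 * igogm_\<alpha> lam j * (\<Sum>i<j. igogm_\<alpha> lam i * b i))\<^sup>2
            / (4 * L * (igogm_A lam j - (igogm_\<alpha> lam j)\<^sup>2)))"
  using \<open>k \<le> K\<close>
proof (induction k)
  let ?h = "\<lambda>k. F (x k) - F xs - 1 / (2 * L) * (norm (G (x k)))\<^sup>2"
  let ?g = "\<lambda>k. G (x k)"
  have opt: "?h k + (?g k \<bullet> ?g k) / L \<le> ?g k \<bullet> (x k - xs)" for k
    using interp[of "x k" xs] \<open>G xs = 0\<close> \<open>L > 0\<close>
    by (simp add: power2_norm_eq_inner inner_diff_right field_simps)
  {
    case 0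
    \<comment> \<open>Since \<open>A\<close> and \<alpha> both start at 1 and no error has entered
      yet, \<open>opt\<close> at 0 settles the base case.\<close>
    have "L / 4 * (norm (w 1 - xs))\<^sup>2
        = L / 4 * (norm (x 0 - xs))\<^sup>2 - ?g 0 \<bullet> (x 0 - xs) + (?g 0 \<bullet> ?g 0) / L"
      using gradient_step_dist[OF \<open>L > 0\<close>, of "x 0" 1 "?g 0" xs] by (simp add: w_def)
    with opt[of 0] have "?h 0 + L / 4 * (norm (w 1 - xs))\<^sup>2 \<le> L / 4 * (norm (x 0 - xs))\<^sup>2"
      by linarith
    then show ?case by simp
  next
    case (Suc k)
    then have "k < K" by simp
    let ?A = "igogm_A lam k" and ?a = "igogm_\<alpha> lam (Suc k)"
    let ?s = "\<Sum>i<Suc k. igogm_\<alpha> lam i *\<^sub>R e i"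
    have nonneg: "0 \<le> igogm_\<alpha> lam i" "1 \<le> igogm_A lam i" if "i \<le> K" for i
      using igogm_nonneg[OF lam that] by auto
    have A_Suc: "igogm_A lam (Suc k) = ?A + ?a" by (simp add: igogm_A.simps)
    have w_Suc: "w (Suc i) = w i - (2 / L * igogm_\<alpha> lam i) *\<^sub>R ?g i" for i
      by (simp add: w_def algebra_simps)
    \<comment> \<open>The recursion of \<open>z\<close> holds only within the first \<open>K\<close>
      steps, hence the bound on \<open>i\<close> in the inner induction.\<close>
    have zw: "z (Suc k) = w (Suc k) - (2 / L) *\<^sub>R ?s"
    proof -
      have "z i = w i - (2 / L) *\<^sub>R (\<Sum>i<i. igogm_\<alpha> lam i *\<^sub>R e i)" if "i \<le> K" for i
        using that
      proof (induction i)
        case 0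
        then show ?case using igogm by (simp add: igogm_def w_def)
      next
        case (Suc i)
        then have z_Suc: "z (Suc i) = z i - (2 / L * igogm_\<alpha> lam i) *\<^sub>R (?g i + e i)"
          and z_i: "z i = w i - (2 / L) *\<^sub>R (\<Sum>i<i. igogm_\<alpha> lam i *\<^sub>R e i)"
          using igogm by (simp_all add: igogm_def)
        show ?case unfolding z_Suc z_i w_Suc by (simp add: algebra_simps)
      qed
      with \<open>k < K\<close> show ?thesis by simp
    qed
    have x_Suc: "(?A + ?a) *\<^sub>R x (Suc k) = ?A *\<^sub>R y (Suc k) + ?a *\<^sub>R z (Suc k)"
    proof -
      have "?A + ?a > 0"
        using nonneg[of k] nonneg[of "Suc k"] \<open>k < K\<close> by linarith
      moreover have "x (Suc k) = (1 - ?a / (?A + ?a)) *\<^sub>R y (Suc k) + (?a / (?A + ?a)) *\<^sub>R z (Suc k)"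
        using igogm \<open>k < K\<close> unfolding igogm_def A_Suc[symmetric] by blast
      ultimately show ?thesis
        by (simp add: scaleR_add_right right_diff_distrib)
    qed
    have prev: "?h (Suc k) + (?g (Suc k) \<bullet> ?g (Suc k)) / L
        \<le> ?h k + ?g (Suc k) \<bullet> (x (Suc k) - y (Suc k)) - (?g (Suc k) \<bullet> e k) / L"
    proof -
      let ?g' = "?g (Suc k)"
      have "y (Suc k) = x k - (1 / L) *\<^sub>R (?g k + e k)"
        using igogm \<open>k < K\<close> by (simp add: igogm_def)
      \<comment> \<open>The inner product of consecutive gradients produced by the step to
        \<open>y\<close> cancels the cross term of the interpolation inequality; only
        \<open>e k\<close> remains.\<close>
      then have "?g' \<bullet> (x (Suc k) - y (Suc k))
          = - (?g' \<bullet> (x k - x (Suc k))) + (?g' \<bullet> ?g k) / L + (?g' \<bullet> e k) / L"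
        by (simp add: inner_simps add_divide_distrib)
      moreover have "1 / (2 * L) * (norm (?g k - ?g'))\<^sup>2
          = 1 / (2 * L) * (norm (?g k))\<^sup>2 + 1 / (2 * L) * (norm ?g')\<^sup>2 - (?g' \<bullet> ?g k) / L"
        using \<open>L > 0\<close> by (simp add: power2_norm_eq_inner inner_simps inner_commute field_simps)
      moreover have "(?g' \<bullet> ?g') / L = 2 * (1 / (2 * L) * (norm ?g')\<^sup>2)"
        by (simp add: power2_norm_eq_inner)
      ultimately show ?thesis
        using interp[of "x (Suc k)" "x k"] by linarith
    qed
    let ?B = "?A * b k + 2 * ?a * (\<Sum>i<Suc k. igogm_\<alpha> lam i * b i)"
    have B: "norm (?A *\<^sub>R e k + (2 * ?a) *\<^sub>R ?s) \<le> ?B"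
    proof (rule norm_triangle_le, rule add_mono)
      show "norm (?A *\<^sub>R e k) \<le> ?A * b k"
        using nonneg[of k] e[of k] \<open>k < K\<close> by (simp add: mult_left_mono)
      have "norm ?s \<le> (\<Sum>i<Suc k. igogm_\<alpha> lam i * b i)"
      proof (rule sum_norm_le)
        fix i assume "i \<in> {..<Suc k}"
        with \<open>k < K\<close> show "norm (igogm_\<alpha> lam i *\<^sub>R e i) \<le> igogm_\<alpha> lam i * b i"
          using nonneg[of i] e[of i] by (simp add: mult_left_mono)
      qed
      with nonneg[of "Suc k"] \<open>k < K\<close>
      show "norm ((2 * ?a) *\<^sub>R ?s) \<le> 2 * ?a * (\<Sum>i<Suc k. igogm_\<alpha> lam i * b i)"
        by (simp add: mult_left_mono del: sum.lessThan_Suc)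
    qed
    have "(?A + ?a) * ?h (Suc k) + L / 4 * (norm (w (Suc (Suc k)) - xs))\<^sup>2
        \<le> ?A * ?h k + L / 4 * (norm (w (Suc k) - xs))\<^sup>2 + ?B\<^sup>2 / (4 * L * (?A + ?a - ?a\<^sup>2))"
      unfolding w_Suc[of "Suc k"]
      by (rule igogm_potential_step[OF \<open>L > 0\<close> _ _ _ x_Suc zw prev opt B])
        (use nonneg[of k] nonneg[of "Suc k"] \<alpha>[rule_format, of "Suc k"] \<open>k < K\<close> in \<open>auto simp: A_Suc\<close>)
    with Suc.IH \<open>k < K\<close> show ?case
      by (simp add: A_Suc del: sum.lessThan_Suc)
  }
qed

theorem theorem1:
  fixes f :: "real ^ 'd \<Rightarrow> ereal"
    and x y z e :: "nat \<Rightarrow> real ^ 'd"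
    and xstar :: "real ^ 'd"
    and lam b :: "nat \<Rightarrow> real"
    and L :: real
    and K :: nat
  assumes "L > 0"
    and "proper_fun f" and "closed_fun f" and "convex_fun f" and "lipschitz_smooth L f"
    and "xstar \<in> solution_set f"
    and "K \<ge> 1"
    and "\<forall>k\<in>{1..K}. 0 \<le> lam k \<and> lam k \<le> 1"
    and "igogm L lam K (\<lambda>k. grad f (x k) + e k) x y z"
    and "\<forall>k<K. b k \<ge> 0 \<and> (norm (e k))\<^sup>2 \<le> (b k)\<^sup>2"
    and "\<forall>k\<in>{1..K}. (igogm_\<alpha> lam k)\<^sup>2 < igogm_A lam k"
  shows "f (x K) - (INF v. f v) - ereal (1 / (2 * L) * (norm (grad f (x K)))\<^sup>2)
           \<le> ereal (L * (norm (x 0 - xstar))\<^sup>2 / (4 * igogm_A lam K)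
                     + (\<Sum>k<K. igogm_u L lam K b k * (b k)\<^sup>2))
       \<and> (\<Sum>k<K. igogm_u L lam K b k * (b k)\<^sup>2)
           = (\<Sum>j = 1..K.
                (igogm_A lam (j - 1) * b (j - 1)
                   + 2 * igogm_\<alpha> lam j * (\<Sum>i<j. igogm_\<alpha> lam i * b i))\<^sup>2
                / (4 * L * igogm_A lam K * (igogm_A lam j - (igogm_\<alpha> lam j)\<^sup>2)))
       \<and> (\<forall>\<beta>>0. (\<forall>i<K. b i = \<beta>) \<longrightarrow>
            (\<forall>k<K. igogm_u L lam K b k =
               igogm_A lam k * (1 + 2 * igogm_\<alpha> lam (k + 1))
                 * (igogm_A lam k + 2 * igogm_\<alpha> lam k * igogm_\<alpha> lam (k + 1))
                 / (4 * L * igogm_A lam K * (igogm_A lam (k + 1) - (igogm_\<alpha> lam (k + 1))\<^sup>2))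
               + (\<Sum>i = k + 1..<K.
                    igogm_A lam i * (1 + 2 * igogm_\<alpha> lam (i + 1))
                      * igogm_\<alpha> lam k * igogm_\<alpha> lam (i + 1)
                    / (2 * L * igogm_A lam K
                         * (igogm_A lam (i + 1) - (igogm_\<alpha> lam (i + 1))\<^sup>2)))))"
proof -
  let ?F = "\<lambda>v. real_of_ereal (f v)"
  let ?A = "igogm_A lam K"
  let ?w = "x 0 - (2 / L) *\<^sub>R (\<Sum>i<Suc K. igogm_\<alpha> lam i *\<^sub>R grad f (x i))"
  \<comment> \<open>The parameter \<open>c\<close> is 1 in the potential bound and \<open>?A\<close>
    after division by \<open>?A\<close>.\<close>
  let ?S = "\<lambda>c. \<Sum>j = 1..K.
    (igogm_A lam (j - 1) * b (j - 1) + 2 * igogm_\<alpha> lam j * (\<Sum>i<j. igogm_\<alpha> lam i * b i))\<^sup>2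
    / (4 * L * c * (igogm_A lam j - (igogm_\<alpha> lam j)\<^sup>2))"
  let ?h = "?F (x K) - ?F xstar - 1 / (2 * L) * (norm (grad f (x K)))\<^sup>2"
  have finite: "\<bar>f v\<bar> \<noteq> \<infinity>" for v
    using assms(5) by (simp add: lipschitz_smooth_def)
  have fF: "f v = ereal (?F v)" for v
    using finite by (simp add: ereal_real)
  have min: "f xstar \<le> f v" for v
    using assms(6) by (simp add: solution_set_def)
  then have F_min: "?F xstar \<le> ?F v" for v
    using fF by (metis ereal_less_eq(3))
  have G: "GDERIV ?F v :> grad f v" for v
    using assms(5) by (intro GDERIV_grad) (simp add: lipschitz_smooth_def)
  have interp: "?F v + grad f v \<bullet> (u - v) + 1 / (2 * L) * (norm (grad f u - grad f v))\<^sup>2 \<le> ?F u"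
    for u v
    using assms(1,5)
    by (intro smooth_convex_interpolation[OF G] convex_fun_imp_convex_on[OF assms(4) finite])
      (auto simp: lipschitz_smooth_def)
  have lam: "\<forall>k\<in>{1..K}. 0 \<le> lam k"
    using assms(8) by auto
  have e: "norm (e k) \<le> b k" if "k < K" for k
    using assms(10) that power2_le_imp_le by blast
  have "?A > 0"
    using igogm_nonneg[OF lam, of K] by simp
  have "?A * ?h + L / 4 * (norm (?w - xstar))\<^sup>2 \<le> L / 4 * (norm (x 0 - xstar))\<^sup>2 + ?S 1"
    using igogm_potential_bound[OF assms(1) interp GDERIV_minimum_eq_0[OF G F_min] lam assms(9) e
        assms(11) order_refl]
    by simp
  \<comment> \<open>The nonnegative distance term of the potential is dropped.\<close>
  then have "?h * ?A \<le> L / 4 * (norm (x 0 - xstar))\<^sup>2 + ?S 1"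
    using assms(1) by (smt (verit) mult.commute mult_nonneg_nonneg divide_nonneg_pos zero_le_power2)
  then have "?h \<le> (L / 4 * (norm (x 0 - xstar))\<^sup>2 + ?S 1) / ?A"
    using \<open>?A > 0\<close> by (simp only: pos_le_divide_eq)
  also have "\<dots> = L * (norm (x 0 - xstar))\<^sup>2 / (4 * ?A) + ?S ?A"
    by (simp add: add_divide_distrib sum_divide_distrib mult_ac)
  finally have bound: "?h \<le> L * (norm (x 0 - xstar))\<^sup>2 / (4 * ?A)
      + (\<Sum>k<K. igogm_u L lam K b k * (b k)\<^sup>2)"
    by (simp only: sum_igogm_u)
  have "(INF v. f v) = f xstar"
    using min by (intro antisym INF_lower INF_greatest) auto
  then have "f (x K) - (INF v. f v) - ereal (1 / (2 * L) * (norm (grad f (x K)))\<^sup>2) = ereal ?h"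
    using fF[of "x K"] fF[of xstar] by (metis ereal_minus(1))
  with bound show ?thesis
    using sum_igogm_u igogm_u_const by (metis (no_types, lifting) ereal_less_eq(3))
qed

end
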